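(* Let $a,b,m$ be positive integers. Then, as an identity in the variables $x_1,\dots,x_a$, $$\sum_{\pi\in\mathrm{PF}(a,b,m)}x_1^{\#1(\pi)}\cdots x_a^{\#a(\pi)}=(x_1+\cdots+x_a)(x_1+\cdots+x_a+mb)^{m-1}.$$
   Context: $\mathrm{PF}(a,b,m)$ is the set of $(a,b)$-parking functions of length $m$: sequences $\pi=(\pi_1,\dots,\pi_m)$ of positive integers whose weakly increasing rearrangement $\lambda_1\le\cdots\le\lambda_m$ satisfies $\lambda_i\le a+(i-1)b$ for $1\le i\le m$. Here $\#i(\pi)=\#\{k:\pi_k=i\}$. *)

theory Defs
  imports Complex_Main
begin

text \<open>Sequences are lists, indexed from 0: the entry \<open>sort \<pi> ! i\<close> is the
  \<open>(i + 1)\<close>-st term of the weakly increasing rearrangement, so the bound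
  \<open>a + ((i + 1) - 1) b\<close> becomes \<open>a + i * b\<close>.\<close>

definition PF :: "nat \<Rightarrow> nat \<Rightarrow> nat \<Rightarrow> nat list set" where
  "PF a b m = {\<pi>. length \<pi> = m \<and> (\<forall>k<m. 0 < \<pi> ! k) \<and> (\<forall>i<m. sort \<pi> ! i \<le> a + i * b)}"

text \<open>Finiteness matters because \<^const>\<open>sum\<close> over an infinite set is 0.\<close>

lemma finite_PF: "finite (PF a b m)"
proof (rule finite_subset)
  show "PF a b m \<subseteq> {\<pi>. set \<pi> \<subseteq> {..a + m * b} \<and> length \<pi> = m}"
  proof (intro subsetI CollectI conjI)
    fix \<pi> x assume \<pi>: "\<pi> \<in> PF a b m" and "x \<in> set \<pi>"
    then have "x \<in> set (sort \<pi>)" by simp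
    then obtain i where i: "i < m" "x = sort \<pi> ! i"
      using \<pi> unfolding in_set_conv_nth by (auto simp: PF_def)
    then have "x \<le> a + i * b" using \<pi> by (simp add: PF_def)
    also have "\<dots> \<le> a + m * b" using i by simp
    finally show "x \<in> {..a + m * b}" by simp
  qed (simp add: PF_def)
qed (simp add: finite_lists_length_eq)

end

theory Submission
  imports Defs
begin

text \<open>Give a positive entry \<open>i\<close> of a list the weight \<open>x i\<close> if \<open>i \<le> a\<close> and the weight \<open>1\<close>
  otherwise, let \<open>S = x 1 + \<dots> + x a\<close>, and let \<open>F m\<close> be the total weight of \<open>PF a b m\<close>, which is
  the left-hand side of the theorem. The total weight of all lists of length \<open>m\<close> over
  \<open>{1..a + m * b}\<close> is \<open>(S + m * b) ^ m\<close>. For such a list \<open>\<pi>\<close> there is exactly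
  one \<open>i \<le> m\<close> for which the entries \<open>\<le> a + i * b\<close> of \<open>\<pi>\<close> form an element of \<open>PF a b i\<close>, namely the
  least \<open>i\<close> for which at most \<open>i\<close> entries are \<open>\<le> a + i * b\<close>. The other \<open>m - i\<close> entries are arbitrary
  in a range of \<open>(m - i) * b\<close> numbers of weight \<open>1\<close>, and the two sublists are shuffled in an
  arbitrary way. Hence
  \<open>(S + m * b) ^ m = (\<Sum>i\<le>m. (m choose i) * F i * ((m - i) * b) ^ (m - i))\<close>
  (lemma \<open>power_eq_sum_PF_weight\<close>). The coefficient of \<open>F m\<close> is \<open>1\<close>, so these equations
  determine \<open>F\<close>. By Abel's binomial theorem (lemma \<open>abel_binomial\<close>) the values
  \<open>S * (S + i * b) ^ (i - 1)\<close> satisfy the same equations.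

  No division or cancellation of factors takes place, so the argument works in every commutative
  ring.\<close>

section \<open>Abel's binomial theorem\<close>

text \<open>This is the vanishing of the \<open>N\<close>-th finite difference of a polynomial of degree \<open>d < N\<close>;
  taking one difference lowers the degree by one.\<close>

lemma alternating_sum_power_eq_0:
  fixes x z :: "'a::comm_ring_1"
  assumes "d < N"
  shows "(\<Sum>k\<le>N. of_nat (N choose k) * (- 1) ^ k * (x + of_nat k * z) ^ d) = 0"
  using assms
proof (induction N arbitrary: d)
  case 0
  then show ?case by simp
next
  case (Suc N)
  define f where "f k = (x + of_nat k * z) ^ d" for k
  define c where "c k = of_nat (N choose k) * (- 1 :: 'a) ^ k" for k
  have diff: "f (Suc k) - f k = (\<Sum>j<d. of_nat (d choose j) * z ^ (d - j) * (x + of_nat k * z) ^ j)" for k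
  proof -
    have "f (Suc k) = ((x + of_nat k * z) + z) ^ d"
      by (simp add: f_def algebra_simps)
    also have "\<dots> = (\<Sum>j\<le>d. of_nat (d choose j) * (x + of_nat k * z) ^ j * z ^ (d - j))"
      by (rule binomial_ring)
    also have "{..d} = insert d {..<d}" by auto
    finally show ?thesis by (simp add: f_def algebra_simps)
  qed
  have "(\<Sum>k\<le>Suc N. of_nat (Suc N choose k) * (- 1) ^ k * f k)
      = f 0 + (\<Sum>k\<le>N. of_nat (Suc N choose Suc k) * (- 1) ^ Suc k * f (Suc k))"
    by (subst sum.atMost_Suc_shift) simp
  also have "\<dots> = (f 0 + (\<Sum>k\<le>N. of_nat (N choose Suc k) * (- 1) ^ Suc k * f (Suc k)))
      - (\<Sum>k\<le>N. c k * f (Suc k))"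
    by (simp add: c_def sum_subtractf[symmetric] algebra_simps sum.distrib[symmetric] sum_negf)
  also have "f 0 + (\<Sum>k\<le>N. of_nat (N choose Suc k) * (- 1) ^ Suc k * f (Suc k))
      = (\<Sum>k\<le>Suc N. c k * f k)"
    unfolding c_def by (subst sum.atMost_Suc_shift) simp
  also have "\<dots> = (\<Sum>k\<le>N. c k * f k)" by (simp add: c_def binomial_eq_0)
  also have "(\<Sum>k\<le>N. c k * f k) - (\<Sum>k\<le>N. c k * f (Suc k))
      = - (\<Sum>k\<le>N. c k * (f (Suc k) - f k))"
    by (simp add: algebra_simps sum_subtractf)
  also have "(\<Sum>k\<le>N. c k * (f (Suc k) - f k))
      = (\<Sum>j<d. of_nat (d choose j) * z ^ (d - j) * (\<Sum>k\<le>N. c k * (x + of_nat k * z) ^ j))"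
    unfolding diff sum_distrib_left by (subst sum.swap) (simp add: algebra_simps)
  also have "\<dots> = 0"
    unfolding c_def by (rule sum.neutral) (use Suc in auto)
  finally show ?case by (simp add: f_def)
qed

text \<open>These are the Abel polynomials. For \<open>k = 0\<close> the exponent is meant to be \<open>- 1\<close>, so that the
  value is \<open>1\<close>, whereas truncated subtraction would give \<open>x\<close>.\<close>

definition abel_poly :: "'a::comm_ring_1 \<Rightarrow> 'a \<Rightarrow> nat \<Rightarrow> 'a" where
  "abel_poly x z k = (if k = 0 then 1 else x * (x + of_nat k * z) ^ (k - 1))"

text \<open>The complementary power raises the exponent to \<open>N - 1\<close> for every \<open>k\<close>, including \<open>k = 0\<close>, so
  summing with binomial coefficients over \<open>k \<le> N\<close> gives a full \<open>N\<close>-th difference of one polynomial.\<close>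

lemma abel_poly_mult_power:
  assumes "k \<le> N" "0 < N"
  shows "abel_poly x z k * (- (x + of_nat k * z)) ^ (N - k)
    = (- 1) ^ N * x * ((- 1) ^ k * (x + of_nat k * z) ^ (N - 1))"
proof -
  let ?y = "x + of_nat k * z"
  have poly: "abel_poly x z k * ?y ^ (N - k) = x * ?y ^ (N - 1)"
  proof (cases "k = 0")
    case True
    then show ?thesis using assms by (simp add: abel_poly_def flip: power_Suc)
  next
    case False
    then have "N - 1 = (k - 1) + (N - k)" using assms by simp
    then show ?thesis using False by (simp only: power_add) (simp add: abel_poly_def mult.assoc)
  qed
  have sign: "(- 1 :: 'a) ^ (N - k) = (- 1) ^ N * (- 1) ^ k"
  proof -
    have "N = (N - k) + k" using assms by simp
    then have "(- 1 :: 'a) ^ N = (- 1) ^ (N - k) * (- 1) ^ k" by (metis power_add)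
    then show ?thesis by (simp add: mult.assoc flip: power_mult_distrib)
  qed
  have "abel_poly x z k * (- ?y) ^ (N - k) = (- 1) ^ (N - k) * (abel_poly x z k * ?y ^ (N - k))"
    by (subst power_minus) (rule mult.left_commute)
  also have "\<dots> = (- 1) ^ N * x * ((- 1) ^ k * ?y ^ (N - 1))"
    unfolding poly sign by (simp only: mult_ac)
  finally show ?thesis .
qed

text \<open>Write \<open>y - k * z = (x + y) - (x + k * z)\<close> and expand in powers of \<open>x + y\<close>: the coefficient of
  \<open>(x + y) ^ j\<close> is, up to a factor, an \<open>(n - j)\<close>-th difference of a polynomial of degree
  \<open>n - j - 1\<close> if \<open>j < n\<close>, hence only \<open>j = n\<close> survives.\<close>

theorem abel_binomial:
  fixes x y z :: "'a::comm_ring_1"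
  shows "(\<Sum>k\<le>n. of_nat (n choose k) * abel_poly x z k * (y - of_nat k * z) ^ (n - k)) = (x + y) ^ n"
proof -
  let ?g = "\<lambda>k j. abel_poly x z k * (- (x + of_nat k * z)) ^ (n - k - j)"
  have expand: "(y - of_nat k * z) ^ (n - k)
      = (\<Sum>j\<le>n - k. of_nat (n - k choose j) * (x + y) ^ j * (- (x + of_nat k * z)) ^ (n - k - j))" for k
    using binomial_ring[of "x + y" "- (x + of_nat k * z)" "n - k"] by simp
  have "(\<Sum>k\<le>n. of_nat (n choose k) * abel_poly x z k * (y - of_nat k * z) ^ (n - k))
      = (\<Sum>k\<le>n. \<Sum>j | j \<in> {..n} \<and> k + j \<le> n.
          of_nat ((n choose k) * (n - k choose j)) * (x + y) ^ j * ?g k j)"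
    unfolding expand sum_distrib_left
    by (intro sum.cong) (auto simp: algebra_simps)
  also have "\<dots> = (\<Sum>j\<le>n. \<Sum>k | k \<in> {..n} \<and> k + j \<le> n.
          of_nat ((n choose k) * (n - k choose j)) * (x + y) ^ j * ?g k j)"
    by (rule sum.swap_restrict) auto
  also have "\<dots> = (\<Sum>j\<le>n. of_nat (n choose j) * (x + y) ^ j
          * (\<Sum>k\<le>n - j. of_nat (n - j choose k) * ?g k j))"
    unfolding sum_distrib_left
  proof (intro sum.cong refl)
    fix j k assume "j \<in> {..n}" "k \<in> {..n - j}"
    then have "k + j \<le> n" by auto
    then have "(n choose k) * (n - k choose j) = (n choose j) * (n - j choose k)"
      using choose_mult[of k "k + j" n] choose_mult[of j "k + j" n]
        binomial_symmetric[of k "k + j"] by simp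
    then show "of_nat ((n choose k) * (n - k choose j)) * (x + y) ^ j * ?g k j
        = of_nat (n choose j) * (x + y) ^ j * (of_nat (n - j choose k) * ?g k j)"
      by (simp add: algebra_simps)
  qed auto
  also have "\<dots> = (\<Sum>j\<le>n. if j = n then (x + y) ^ n else 0)"
  proof (intro sum.cong refl)
    fix j assume j: "j \<in> {..n}"
    show "of_nat (n choose j) * (x + y) ^ j * (\<Sum>k\<le>n - j. of_nat (n - j choose k) * ?g k j)
        = (if j = n then (x + y) ^ n else 0)"
    proof (cases "j = n")
      case True
      then show ?thesis by (simp add: abel_poly_def)
    next
      case False
      define N where "N = n - j"
      have N: "0 < N" using False j by (simp add: N_def)
      have "(\<Sum>k\<le>N. of_nat (N choose k) * ?g k j)
          = (\<Sum>k\<le>N. (- 1) ^ N * x * (of_nat (N choose k) * (- 1) ^ k * (x + of_nat k * z) ^ (N - 1)))"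
      proof (intro sum.cong refl)
        fix k assume k: "k \<in> {..N}"
        have "n - k - j = N - k" by (simp add: N_def)
        then have "?g k j = (- 1) ^ N * x * ((- 1) ^ k * (x + of_nat k * z) ^ (N - 1))"
          using abel_poly_mult_power[of k N x z] k N by simp
        then show "of_nat (N choose k) * ?g k j
            = (- 1) ^ N * x * (of_nat (N choose k) * (- 1) ^ k * (x + of_nat k * z) ^ (N - 1))"
          by (simp add: mult_ac)
      qed
      also have "\<dots> = 0"
        using alternating_sum_power_eq_0[of "N - 1" N x z] N by (simp flip: sum_distrib_left)
      finally show ?thesis using False by (simp add: N_def)
    qed
  qed
  also have "\<dots> = (x + y) ^ n" by simp
  finally show ?thesis .
qed

section \<open>Weights of lists\<close>

lemma sum_prod_list_lists:
  fixes w :: "'b \<Rightarrow> 'a::comm_ring_1"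
  assumes "finite A"
  shows "(\<Sum>xs | set xs \<subseteq> A \<and> length xs = n. prod_list (map w xs)) = (\<Sum>i\<in>A. w i) ^ n"
proof (induction n)
  case 0
  have "{xs. set xs \<subseteq> A \<and> length xs = 0} = {[]}" by auto
  then show ?case by simp
next
  case (Suc n)
  let ?L = "{xs. set xs \<subseteq> A \<and> length xs = n}"
  have "(\<Sum>xs | set xs \<subseteq> A \<and> length xs = Suc n. prod_list (map w xs))
      = (\<Sum>(xs, i)\<in>?L \<times> A. w i * prod_list (map w xs))"
    unfolding lists_length_Suc_eq
    by (subst sum.reindex) (auto simp: inj_on_def intro!: sum.cong)
  also have "\<dots> = (\<Sum>xs\<in>?L. \<Sum>i\<in>A. w i * prod_list (map w xs))"
    by (rule sum.cartesian_product[symmetric])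
  also have "\<dots> = (\<Sum>i\<in>A. w i) * (\<Sum>xs\<in>?L. prod_list (map w xs))"
    by (subst sum_product) (rule sum.swap)
  finally show ?case by (simp add: Suc)
qed

lemma prod_list_map_shuffles:
  fixes w :: "'b \<Rightarrow> 'a::comm_monoid_mult"
  assumes "zs \<in> shuffles xs ys"
  shows "prod_list (map w zs) = prod_list (map w xs) * prod_list (map w ys)"
  using assms by (induction xs ys arbitrary: zs rule: shuffles.induct) (auto simp: mult_ac)

text \<open>The value \<open>1\<close> above \<open>a\<close> makes the weight of a list multiplicative over its entries while
  keeping it equal to the monomial in \<open>x 1, \<dots>, x a\<close>.\<close>

definition entry_weight :: "nat \<Rightarrow> (nat \<Rightarrow> 'a::comm_ring_1) \<Rightarrow> nat \<Rightarrow> 'a" where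
  "entry_weight a x i = (if i \<le> a then x i else 1)"

lemma prod_power_count_list:
  assumes "\<forall>i\<in>set \<pi>. 0 < i"
  shows "(\<Prod>i=1..a. x i ^ count_list \<pi> i) = prod_list (map (entry_weight a x) \<pi>)"
  using assms
proof (induction \<pi>)
  case Nil
  then show ?case by simp
next
  case (Cons p \<pi>)
  have "(\<Prod>i=1..a. x i ^ count_list (p # \<pi>) i)
      = (\<Prod>i=1..a. (if i = p then x p else 1) * x i ^ count_list \<pi> i)"
    by (intro prod.cong) auto
  also have "\<dots> = (\<Prod>i=1..a. if i = p then x p else 1) * (\<Prod>i=1..a. x i ^ count_list \<pi> i)"
    by (rule prod.distrib)
  also have "(\<Prod>i=1..a. if i = p then x p else 1) = entry_weight a x p"
    using Cons.prems by (auto simp: entry_weight_def)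
  finally show ?case using Cons by simp
qed

section \<open>The parking part of a list\<close>

lemma sorted_nth_le_iff:
  fixes xs :: "'a::linorder list"
  assumes "sorted xs" "i < length xs"
  shows "xs ! i \<le> c \<longleftrightarrow> i < length (filter (\<lambda>x. x \<le> c) xs)"
  using assms
proof (induction xs arbitrary: i)
  case Nil
  then show ?case by simp
next
  case (Cons y ys)
  show ?case
  proof (cases "y \<le> c")
    case True
    then show ?thesis using Cons by (cases i) auto
  next
    case False
    then have "c < z" if "z \<in> set (y # ys)" for z using Cons.prems(1) that by auto
    then have "filter (\<lambda>x. x \<le> c) (y # ys) = []" and "c < (y # ys) ! i"
      using Cons.prems(2) nth_mem by (auto simp only: filter_empty_conv not_le)
    then show ?thesis by simp
  qed
qed

text \<open>The number of entries up to a threshold does not change when entries beyond the threshold are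
  removed. This makes counting better suited than sorting to comparing a list with its sublist of
  small entries.\<close>

lemma PF_iff_length_filter:
  "\<pi> \<in> PF a b m \<longleftrightarrow> length \<pi> = m \<and> (\<forall>k\<in>set \<pi>. 0 < k)
    \<and> (\<forall>i<m. i < length (filter (\<lambda>k. k \<le> a + i * b) \<pi>))"
proof -
  have "sort \<pi> ! i \<le> c \<longleftrightarrow> i < length (filter (\<lambda>k. k \<le> c) \<pi>)" if "i < length \<pi>" for i c
    using sorted_nth_le_iff[of "sort \<pi>" i c] that by (simp add: filter_sort)
  then show ?thesis by (auto simp: PF_def all_set_conv_all_nth)
qed

lemma PF_entries:
  assumes "\<pi> \<in> PF a b m" "p \<in> set \<pi>"
  shows "0 < p" "p \<le> a + m * b"
proof -
  show "0 < p" using assms by (simp add: PF_iff_length_filter)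
  have "p \<in> set (sort \<pi>)" using assms(2) by simp
  then obtain i where "i < m" "p = sort \<pi> ! i"
    using assms(1) unfolding in_set_conv_nth by (auto simp: PF_def)
  then have "p \<le> a + i * b" "i * b \<le> m * b" using assms by (auto simp: PF_def)
  then show "p \<le> a + m * b" by linarith
qed

text \<open>The parking part exists at the least \<open>i\<close> for which at most \<open>i\<close> entries are \<open>\<le> a + i * b\<close>:
  minimality gives the bounds at all smaller thresholds, and the bound at \<open>i - 1\<close> forces the number
  of these entries to be exactly \<open>i\<close>. It is unique because a parking part of length \<open>j > i\<close> requires
  more than \<open>i\<close> entries \<open>\<le> a + i * b\<close>.\<close>

lemma ex1_parking_part:
  assumes "\<forall>k\<in>set \<pi>. 0 < k"
  shows "\<exists>!i. i \<le> length \<pi> \<and> filter (\<lambda>k. k \<le> a + i * b) \<pi> \<in> PF a b i"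
proof -
  define n where "n i = length (filter (\<lambda>k. k \<le> a + i * b) \<pi>)" for i
  have n_mono: "n i \<le> n j" if "i \<le> j" for i j
  proof -
    have "a + i * b \<le> a + j * b" using that by simp
    then have "filter (\<lambda>k. k \<le> a + i * b) \<pi> = filter (\<lambda>k. k \<le> a + i * b) (filter (\<lambda>k. k \<le> a + j * b) \<pi>)"
      unfolding filter_filter by (intro filter_cong refl) linarith
    then show ?thesis unfolding n_def by (metis length_filter_le)
  qed
  have PF_iff: "filter (\<lambda>k. k \<le> a + i * b) \<pi> \<in> PF a b i \<longleftrightarrow> n i = i \<and> (\<forall>j<i. j < n j)" for i
  proof -
    have "filter (\<lambda>k. k \<le> a + j * b) (filter (\<lambda>k. k \<le> a + i * b) \<pi>) = filter (\<lambda>k. k \<le> a + j * b) \<pi>"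
      if "j < i" for j
    proof -
      have "a + j * b \<le> a + i * b" using that by simp
      then show ?thesis unfolding filter_filter by (intro filter_cong refl) linarith
    qed
    then show ?thesis using assms by (auto simp: PF_iff_length_filter n_def)
  qed
  define i where "i = (LEAST i. n i \<le> i)"
  have bound: "n (length \<pi>) \<le> length \<pi>" by (simp add: n_def)
  then have "n i \<le> i" unfolding i_def by (rule LeastI)
  moreover have i_le: "i \<le> length \<pi>" unfolding i_def using bound by (rule Least_le)
  moreover have less: "j < n j" if "j < i" for j
    using not_less_Least[of j "\<lambda>i. n i \<le> i"] that by (simp add: i_def)
  moreover have "i \<le> n i"
  proof (cases i)
    case (Suc j)
    then have "j < n j" using less by simp
    then show ?thesis using n_mono[of j i] Suc by simp
  qed simp
  ultimately have "i \<le> length \<pi> \<and> filter (\<lambda>k. k \<le> a + i * b) \<pi> \<in> PF a b i"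
    by (simp add: PF_iff)
  moreover have "i' = j'" if "n i' = i'" "n j' = j'" "\<forall>j<i'. j < n j" "\<forall>j<j'. j < n j" for i' j'
    using that by (metis less_irrefl linorder_neqE_nat)
  ultimately show ?thesis by (auto simp: PF_iff)
qed

section \<open>Total weights\<close>

definition PF_weight :: "nat \<Rightarrow> nat \<Rightarrow> (nat \<Rightarrow> 'a::comm_ring_1) \<Rightarrow> nat \<Rightarrow> 'a" where
  "PF_weight a b x m = (\<Sum>\<pi>\<in>PF a b m. prod_list (map (entry_weight a x) \<pi>))"

lemma sum_entry_weight_atLeastAtMost:
  "(\<Sum>k=1..a + n. entry_weight a x k) = (\<Sum>k=1..a. x k) + of_nat n"
  by (induction n) (auto simp: entry_weight_def)

text \<open>A list whose parking part has length \<open>i\<close> is determined by this part, by the list of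
  the remaining entries and by a way of shuffling the two, of which there are \<open>m choose i\<close> since the
  two lists have no common entries.\<close>

lemma sum_parking_part_eq:
  fixes x :: "nat \<Rightarrow> 'a::comm_ring_1"
  assumes "i \<le> m"
  shows "(\<Sum>\<pi> | (set \<pi> \<subseteq> {1..a + m * b} \<and> length \<pi> = m) \<and> filter (\<lambda>k. k \<le> a + i * b) \<pi> \<in> PF a b i.
      prod_list (map (entry_weight a x) \<pi>))
    = of_nat (m choose i) * PF_weight a b x i * of_nat ((m - i) * b) ^ (m - i)"
    (is "sum ?w ?A = _")
proof -
  let ?P = "\<lambda>k. k \<le> a + i * b"
  define R where "R = {\<beta>. set \<beta> \<subseteq> {a + i * b<..a + m * b} \<and> length \<beta> = m - i}"
  have finR: "finite R" unfolding R_def by (rule finite_lists_length_eq) simp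
  have finA: "finite ?A"
    by (rule finite_subset[OF _ finite_lists_length_eq[of "{1..a + m * b}" m]]) auto
  have le: "a + i * b \<le> a + m * b" using assms by simp
  have maps: "partition ?P ` ?A \<subseteq> PF a b i \<times> R"
  proof (rule image_subsetI)
    fix \<pi> assume \<pi>: "\<pi> \<in> ?A"
    then have "length (filter ?P \<pi>) = i" by (simp add: PF_def)
    then have "filter (\<lambda>k. \<not> ?P k) \<pi> \<in> R"
      using \<pi> sum_length_filter_compl[of ?P \<pi>] by (auto simp: R_def)
    then show "partition ?P \<pi> \<in> PF a b i \<times> R"
      using \<pi> by (simp add: comp_def)
  qed
  have fibre: "{\<pi> \<in> ?A. partition ?P \<pi> = (\<alpha>, \<beta>)} = shuffles \<alpha> \<beta>"
    and card_fibre: "card (shuffles \<alpha> \<beta>) = m choose i"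
    if \<alpha>: "\<alpha> \<in> PF a b i" and \<beta>: "\<beta> \<in> R" for \<alpha> \<beta>
  proof -
    have small: "\<forall>k\<in>set \<alpha>. ?P k" using PF_entries[OF \<alpha>] by auto
    have large: "\<forall>k\<in>set \<beta>. \<not> ?P k" using \<beta> by (auto simp: R_def)
    have len: "length \<alpha> = i" "length \<beta> = m - i" using \<alpha> \<beta> by (auto simp: PF_def R_def)
    have inv: "partition ?P -` {(\<alpha>, \<beta>)} = shuffles \<alpha> \<beta>"
      using small large by (intro inv_image_partition) auto
    have "shuffles \<alpha> \<beta> \<subseteq> ?A"
    proof
      fix \<pi> assume \<pi>: "\<pi> \<in> shuffles \<alpha> \<beta>"
      then have "partition ?P \<pi> = (\<alpha>, \<beta>)" using inv by blast
      then have "filter ?P \<pi> = \<alpha>" by simp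
      moreover have "set \<pi> = set \<alpha> \<union> set \<beta>" "length \<pi> = m"
        using set_shuffles[OF \<pi>] length_shuffles[OF \<pi>] len assms by auto
      moreover have "set \<alpha> \<subseteq> {1..a + m * b}"
      proof
        fix k assume "k \<in> set \<alpha>"
        then have "0 < k" "k \<le> a + m * b" using PF_entries[OF \<alpha>, of k] le by linarith+
        then show "k \<in> {1..a + m * b}" by simp
      qed
      moreover have "set \<beta> \<subseteq> {1..a + m * b}"
        using \<beta> by (auto simp: R_def)
      ultimately show "\<pi> \<in> ?A" using \<alpha> by auto
    qed
    then show "{\<pi> \<in> ?A. partition ?P \<pi> = (\<alpha>, \<beta>)} = shuffles \<alpha> \<beta>"
      using inv by blast
    have "set \<alpha> \<inter> set \<beta> = {}" using small large by blast
    then show "card (shuffles \<alpha> \<beta>) = m choose i"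
      using card_disjoint_shuffles[of \<alpha> \<beta>] len assms by simp
  qed
  have "sum ?w ?A = (\<Sum>q\<in>PF a b i \<times> R. sum ?w {\<pi> \<in> ?A. partition ?P \<pi> = q})"
    using sum.group[OF finA finite_cartesian_product[OF finite_PF finR] maps, of ?w] by simp
  also have "\<dots> = (\<Sum>(\<alpha>, \<beta>)\<in>PF a b i \<times> R. of_nat (m choose i) * (?w \<alpha> * ?w \<beta>))"
  proof (intro sum.cong refl, clarify)
    fix \<alpha> \<beta> assume *: "\<alpha> \<in> PF a b i" "\<beta> \<in> R"
    have "sum ?w (shuffles \<alpha> \<beta>) = (\<Sum>\<pi>\<in>shuffles \<alpha> \<beta>. ?w \<alpha> * ?w \<beta>)"
      by (intro sum.cong refl prod_list_map_shuffles)
    then show "sum ?w {\<pi> \<in> ?A. partition ?P \<pi> = (\<alpha>, \<beta>)} = of_nat (m choose i) * (?w \<alpha> * ?w \<beta>)"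
      unfolding fibre[OF *] by (simp add: card_fibre[OF *])
  qed
  also have "\<dots> = (\<Sum>\<alpha>\<in>PF a b i. \<Sum>\<beta>\<in>R. of_nat (m choose i) * (?w \<alpha> * ?w \<beta>))"
    by (rule sum.cartesian_product[symmetric])
  also have "\<dots> = of_nat (m choose i) * (PF_weight a b x i * sum ?w R)"
    by (simp add: PF_weight_def sum_product flip: sum_distrib_left)
  also have "sum ?w R = (\<Sum>k\<in>{a + i * b<..a + m * b}. entry_weight a x k) ^ (m - i)"
    unfolding R_def by (rule sum_prod_list_lists) simp
  also have "(\<Sum>k\<in>{a + i * b<..a + m * b}. entry_weight a x k) = (\<Sum>k\<in>{a + i * b<..a + m * b}. 1)"
    by (intro sum.cong) (auto simp: entry_weight_def)
  also have "\<dots> = of_nat ((m - i) * b)" by (simp add: diff_mult_distrib)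
  finally show ?thesis by (simp add: mult.assoc)
qed

lemma power_eq_sum_PF_weight:
  fixes x :: "nat \<Rightarrow> 'a::comm_ring_1"
  shows "((\<Sum>k=1..a. x k) + of_nat (m * b)) ^ m
    = (\<Sum>i\<le>m. of_nat (m choose i) * PF_weight a b x i * of_nat ((m - i) * b) ^ (m - i))"
proof -
  let ?w = "\<lambda>\<pi>. prod_list (map (entry_weight a x) \<pi>)"
  define A where "A = {\<pi>. set \<pi> \<subseteq> {1..a + m * b} \<and> length \<pi> = m}"
  define B where "B i = {\<pi> \<in> A. filter (\<lambda>k. k \<le> a + i * b) \<pi> \<in> PF a b i}" for i
  have finA: "finite A" unfolding A_def by (rule finite_lists_length_eq) simp
  have ex1: "\<exists>!i. i \<le> m \<and> \<pi> \<in> B i" if "\<pi> \<in> A" for \<pi>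
  proof -
    have "\<forall>k\<in>set \<pi>. 0 < k" "length \<pi> = m" using that by (auto simp: A_def)
    then show ?thesis using ex1_parking_part[of \<pi> a b] that by (simp add: B_def)
  qed
  have B_subset: "B i \<subseteq> A" for i by (auto simp: B_def)
  have A_eq: "A = (\<Union>i\<le>m. B i)"
  proof (intro equalityI subsetI)
    fix \<pi> assume "\<pi> \<in> A"
    then obtain i where "i \<le> m" "\<pi> \<in> B i" using ex1 by blast
    then show "\<pi> \<in> (\<Union>i\<le>m. B i)" by auto
  qed (use B_subset in auto)
  have disj: "B i \<inter> B j = {}" if "i \<le> m" "j \<le> m" "i \<noteq> j" for i j
    
  proof (rule ccontr)
    assume "B i \<inter> B j \<noteq> {}"
    then obtain \<pi> where "\<pi> \<in> B i" "\<pi> \<in> B j" by blast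
    then show False using ex1[of \<pi>] B_subset that by blast
  qed
  have "((\<Sum>k=1..a. x k) + of_nat (m * b)) ^ m = sum ?w A"
    unfolding A_def by (subst sum_prod_list_lists) (simp_all only: sum_entry_weight_atLeastAtMost finite_atLeastAtMost)
  also have "\<dots> = (\<Sum>i\<le>m. sum ?w (B i))"
    unfolding A_eq
    by (rule sum.UNION_disjoint) (use finite_subset[OF B_subset finA] disj in auto)
  also have "\<dots> = (\<Sum>i\<le>m. of_nat (m choose i) * PF_weight a b x i * of_nat ((m - i) * b) ^ (m - i))"
    unfolding B_def A_def by (intro sum.cong refl) (simp only: mem_Collect_eq atMost_iff sum_parking_part_eq)
  finally show ?thesis .
qed

text \<open>Both sides satisfy the recurrence of \<open>power_eq_sum_PF_weight\<close>; for the right-hand side this is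
  Abel's theorem with \<open>x = S\<close>, \<open>y = m * b\<close> and \<open>z = b\<close>. The terms below the top index agree by
  induction, and the top terms have coefficient \<open>1\<close>.\<close>

theorem PF_weight_eq_abel_poly:
  "PF_weight a b x m = abel_poly (\<Sum>k=1..a. x k) (of_nat b) m"
proof (induction m rule: less_induct)
  case (less m)
  let ?S = "\<Sum>k=1..a. x k"
  let ?c = "\<lambda>f i. of_nat (m choose i) * f i * of_nat ((m - i) * b) ^ (m - i)"
  have "(\<Sum>i\<le>m. ?c (PF_weight a b x) i) = (?S + of_nat (m * b)) ^ m"
    by (rule power_eq_sum_PF_weight[symmetric])
  also have "\<dots> = (\<Sum>i\<le>m. of_nat (m choose i) * abel_poly ?S (of_nat b) i
      * (of_nat (m * b) - of_nat i * of_nat b) ^ (m - i))"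
    by (rule abel_binomial[symmetric])
  also have "\<dots> = (\<Sum>i\<le>m. ?c (abel_poly ?S (of_nat b)) i)"
    by (intro sum.cong refl) (simp add: of_nat_diff algebra_simps)
  finally have "(\<Sum>i<m. ?c (PF_weight a b x) i) + PF_weight a b x m
      = (\<Sum>i<m. ?c (abel_poly ?S (of_nat b)) i) + abel_poly ?S (of_nat b) m"
    by (simp add: lessThan_Suc_atMost[symmetric])
  moreover have "(\<Sum>i<m. ?c (PF_weight a b x) i) = (\<Sum>i<m. ?c (abel_poly ?S (of_nat b)) i)"
    using less by (intro sum.cong) auto
  ultimately show ?case by simp
qed

theorem proposition7p3:
  fixes a b m :: nat and x :: "nat \<Rightarrow> 'a::comm_ring_1"
  assumes "0 < a" and "0 < b" and "0 < m"
  shows "(\<Sum>\<pi>\<in>PF a b m. \<Prod>i=1..a. x i ^ count_list \<pi> i) =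
    (\<Sum>i=1..a. x i) * ((\<Sum>i=1..a. x i) + of_nat (m * b)) ^ (m - 1)"
proof -
  have "(\<Sum>\<pi>\<in>PF a b m. \<Prod>i=1..a. x i ^ count_list \<pi> i) = PF_weight a b x m"
    unfolding PF_weight_def
    by (intro sum.cong refl prod_power_count_list) (auto dest: PF_entries)
  then show ?thesis
    using assms by (simp add: PF_weight_eq_abel_poly abel_poly_def)
qed

end
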